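(* Let $H$ be a finite edge-weighted graph with (real symmetric) adjacency matrix $A$, and suppose $A$ has minimum polynomial $$p_A(t)=p_0+p_1t+\cdots+p_\ell t^\ell .$$ (i) If $p_0\neq0$ (i.e. if $0$ is not an eigenvalue of $A$), then a connector for $\mathrm{hom}(\,\cdot\,,H)$ is given by $$Z=-\frac{1}{p_0}\left[p_1P_2+p_2P_3+\cdots+p_\ell P_{\ell+1}\right],$$ where $P_k$ is the path with $k$ edges with one endpoint labelled $1$ and the other labelled $2$. Also, a contractor for $\mathrm{hom}(\,\cdot\,,H)$ is given by $$Z=-\frac{1}{p_0}\left[p_1P_1+p_2P_2+\cdots+p_\ell P_\ell\right].$$ (ii) If $p_0=0$, then $p_1\neq0$ and a connector for $\mathrm{hom}(\,\cdot\,,H)$ is given by $$Z=-\frac{1}{p_1}\left[p_2P_2+\cdots+p_\ell P_\ell\right].$$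
   Context: **Homomorphism numbers.** An edge-weighted graph $H$ has all vertex weights 1, real edge weights $\beta_H(ij)$, and symmetric adjacency matrix $A=(\beta_H(ij))_{i,j\in V(H)}$. For a finite graph $G$, $\mathrm{hom}(G,H)=\sum_{\psi:V(G)\to V(H)}\prod_{uv\in E(G)}\beta_H(\psi(u)\psi(v))$, the product taken over edges with multiplicity (a loop at $u$ contributes $\beta_H(\psi(u)\psi(u))$). **2-labelled graphs.** A 2-labelled graph is a finite graph $X$, without loops but possibly with parallel edges, together with a map $\lambda:\{1,2\}\to V(X)$ (the vertex $\lambda(i)$ is said to carry label $i$; a vertex may carry both labels). It is simple if it has no parallel edges, $\lambda$ is injective, and the two labelled vertices are non-adjacent. A (simple) 2-labelled quantum graph is a finite formal linear combination of (simple) 2-labelled graphs with real coefficients. The product $XY$ of 2-labelled graphs is obtained by taking the disjoint union of $X$ and $Y$ and identifying vertices carrying the same label (keeping all edges, with multiplicity; loops may arise); it is extended bilinearly to quantum graphs. $K_1$ denotes a single vertex carrying both labels, so $XK_1$ is $X$ with its vertices labelled 1 and 2 identified. $P_1$ is a single edge with ends labelled 1 and 2, so $XP_1$ is $X$ with an edge added between the vertices labelled 1 and 2. **Contractor and connector.** A graph parameter $h$ (an isomorphism-invariant function on graphs) is evaluated on a 2-labelled graph by ignoring labels and is extended linearly to 2-labelled quantum graphs. A 2-labelled quantum graph $Z$ is a contractor for $h$ if $h(XZ)=h(XK_1)$ for every 2-labelled graph $X$ whose vertices labelled 1 and 2 are distinct and non-adjacent (equivalently, for all linear combinations of such $X$).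 A simple 2-labelled quantum graph $Z$ is a connector for $h$ if $h(XZ)=h(XP_1)$ for every 2-labelled graph $X$ (equivalently, every 2-labelled quantum graph $X$). *)

theory Defs
  imports
    "HOL-Analysis.Analysis"
    "HOL-Computational_Algebra.Polynomial"
    "HOL-Library.Uprod"
    "HOL-Library.Multiset"
    "HOL-Library.Nat_Bijection"
    "HOL-Library.Poly_Mapping"
begin

section \<open>Finite multigraphs and homomorphism numbers\<close>

text \<open>
  Edges are unordered pairs counted with multiplicity; \<open>Upair v v\<close> is a loop.  Every finite graph
  is isomorphic to one whose vertices are natural numbers, and a fixed vertex type makes it possible
  to treat a graph parameter as an ordinary function on graphs.
\<close>

record mgraph =
  verts :: "nat set"
  edges :: "nat uprod multiset"

definition finite_graph :: "'z mgraph_scheme \<Rightarrow> bool" where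
  "finite_graph G \<longleftrightarrow> finite (verts G) \<and> (\<forall>e \<in># edges G. set_uprod e \<subseteq> verts G)"

definition graph_iso :: "mgraph \<Rightarrow> mgraph \<Rightarrow> bool" where
  "graph_iso G G' \<longleftrightarrow>
     (\<exists>f. bij_betw f (verts G) (verts G') \<and> edges G' = image_mset (map_uprod f) (edges G))"

definition graph_parameter :: "(mgraph \<Rightarrow> real) \<Rightarrow> bool" where
  "graph_parameter h \<longleftrightarrow>
     (\<forall>G G'. finite_graph G \<longrightarrow> finite_graph G' \<longrightarrow> graph_iso G G' \<longrightarrow> h G = h G')"

text \<open>
  An edge-weighted graph with vertex set \<open>'n\<close> is given by its edge weights, a function on unordered
  pairs.  Its adjacency matrix is therefore symmetric by construction, and every real symmetric
  matrix arises in this way.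
\<close>

definition adjacency_matrix :: "('n::finite uprod \<Rightarrow> real) \<Rightarrow> real ^ 'n ^ 'n" where
  "adjacency_matrix \<beta> = (\<chi> i j. \<beta> (Upair i j))"

definition hom_number :: "('n::finite uprod \<Rightarrow> real) \<Rightarrow> mgraph \<Rightarrow> real" where
  "hom_number \<beta> G = (\<Sum>\<psi> \<in> verts G \<rightarrow>\<^sub>E UNIV. \<Prod>e \<in># edges G. \<beta> (map_uprod \<psi> e))"


section \<open>2-labelled graphs and quantum graphs\<close>

record lgraph = mgraph +
  label1 :: nat
  label2 :: nat

definition unlabel :: "lgraph \<Rightarrow> mgraph" where
  "unlabel X = \<lparr>verts = verts X, edges = edges X\<rparr>"

definition two_labelled :: "lgraph \<Rightarrow> bool" where
  "two_labelled X \<longleftrightarrow>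
     finite_graph X \<and> (\<forall>v. Upair v v \<notin># edges X) \<and> label1 X \<in> verts X \<and> label2 X \<in> verts X"

definition labels_separated :: "lgraph \<Rightarrow> bool" where
  "labels_separated X \<longleftrightarrow> label1 X \<noteq> label2 X \<and> Upair (label1 X) (label2 X) \<notin># edges X"

definition simple_two_labelled :: "lgraph \<Rightarrow> bool" where
  "simple_two_labelled X \<longleftrightarrow>
     two_labelled X \<and> (\<forall>e. count (edges X) e \<le> 1) \<and> labels_separated X"

text \<open>
  In the product, the two vertex sets are made disjoint by \<open>sum_encode\<close>; the identifications are
  generated by \<open>glue X Y\<close>, and each class of identified vertices is represented by its least
  element.  Since one of the factors may carry both labels at one vertex, a class may contain up to
  three vertices.  The product may have loops, and then it is not \<open>two_labelled\<close> itself.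
\<close>

definition glue :: "lgraph \<Rightarrow> lgraph \<Rightarrow> nat \<Rightarrow> nat \<Rightarrow> bool" where
  "glue X Y u v \<longleftrightarrow>
     u = sum_encode (Inl (label1 X)) \<and> v = sum_encode (Inr (label1 Y)) \<or>
     u = sum_encode (Inl (label2 X)) \<and> v = sum_encode (Inr (label2 Y))"

definition glue_rep :: "lgraph \<Rightarrow> lgraph \<Rightarrow> nat + nat \<Rightarrow> nat" where
  "glue_rep X Y w = (LEAST u. equivclp (glue X Y) (sum_encode w) u)"

definition lprod :: "lgraph \<Rightarrow> lgraph \<Rightarrow> lgraph" where
  "lprod X Y =
     \<lparr>verts = glue_rep X Y ` (Inl ` verts X \<union> Inr ` verts Y),
      edges = image_mset (map_uprod (\<lambda>v. glue_rep X Y (Inl v))) (edges X) +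
              image_mset (map_uprod (\<lambda>v. glue_rep X Y (Inr v))) (edges Y),
      label1 = glue_rep X Y (Inl (label1 X)),
      label2 = glue_rep X Y (Inl (label2 X))\<rparr>"

definition K1 :: lgraph where
  "K1 = \<lparr>verts = {0}, edges = {#}, label1 = 0, label2 = 0\<rparr>"

definition path_graph :: "nat \<Rightarrow> lgraph" where
  "path_graph k =
     \<lparr>verts = {0..k}, edges = image_mset (\<lambda>i. Upair i (Suc i)) (mset_set {0..<k}),
      label1 = 0, label2 = k\<rparr>"

type_synonym quantum_graph = "lgraph \<Rightarrow>\<^sub>0 real"

definition qsingle :: "lgraph \<Rightarrow> quantum_graph" where
  "qsingle X = Poly_Mapping.single X 1"

definition qscale :: "real \<Rightarrow> quantum_graph \<Rightarrow> quantum_graph" where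
  "qscale c Z = Poly_Mapping.map ((*) c) Z"

definition qprod :: "quantum_graph \<Rightarrow> quantum_graph \<Rightarrow> quantum_graph" where
  "qprod V Z =
     (\<Sum>X \<in> Poly_Mapping.keys V. \<Sum>Y \<in> Poly_Mapping.keys Z.
        Poly_Mapping.single (lprod X Y) (Poly_Mapping.lookup V X * Poly_Mapping.lookup Z Y))"

definition qeval :: "(mgraph \<Rightarrow> real) \<Rightarrow> quantum_graph \<Rightarrow> real" where
  "qeval h Z = (\<Sum>X \<in> Poly_Mapping.keys Z. Poly_Mapping.lookup Z X * h (unlabel X))"

definition is_contractor :: "(mgraph \<Rightarrow> real) \<Rightarrow> quantum_graph \<Rightarrow> bool" where
  "is_contractor h Z \<longleftrightarrow>
     graph_parameter h \<and> (\<forall>Y \<in> Poly_Mapping.keys Z. two_labelled Y) \<and>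
     (\<forall>X. two_labelled X \<longrightarrow> labels_separated X \<longrightarrow>
        qeval h (qprod (qsingle X) Z) = h (unlabel (lprod X K1)))"

definition is_connector :: "(mgraph \<Rightarrow> real) \<Rightarrow> quantum_graph \<Rightarrow> bool" where
  "is_connector h Z \<longleftrightarrow>
     graph_parameter h \<and> (\<forall>Y \<in> Poly_Mapping.keys Z. simple_two_labelled Y) \<and>
     (\<forall>X. two_labelled X \<longrightarrow>
        qeval h (qprod (qsingle X) Z) = h (unlabel (lprod X (path_graph 1))))"


section \<open>Minimum polynomial of a matrix\<close>

definition mat_power :: "real ^ 'n ^ 'n \<Rightarrow> nat \<Rightarrow> real ^ 'n ^ 'n" where
  "mat_power A k = (((**) A) ^^ k) (mat 1)"

definition poly_mat :: "real poly \<Rightarrow> real ^ 'n ^ 'n \<Rightarrow> real ^ 'n ^ 'n" where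
  "poly_mat p A = (\<Sum>k\<le>degree p. coeff p k *\<^sub>R mat_power A k)"

definition is_min_poly :: "real ^ 'n ^ 'n \<Rightarrow> real poly \<Rightarrow> bool" where
  "is_min_poly A p \<longleftrightarrow>
     lead_coeff p = 1 \<and> poly_mat p A = 0 \<and>
     (\<forall>q. q \<noteq> 0 \<longrightarrow> poly_mat q A = 0 \<longrightarrow> degree p \<le> degree q)"

definition is_eigenvalue :: "real ^ 'n ^ 'n \<Rightarrow> real \<Rightarrow> bool" where
  "is_eigenvalue A c \<longleftrightarrow> (\<exists>v. v \<noteq> 0 \<and> A *v v = c *s v)"

lemma poly_mat_bound:
  assumes "degree p \<le> N"
  shows "poly_mat p A = (\<Sum>k\<le>N. coeff p k *\<^sub>R mat_power A k)"
  unfolding poly_mat_def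
  by (rule sum.mono_neutral_left) (use assms in \<open>auto simp: not_le coeff_eq_0\<close>)

lemma poly_mat_diff: "poly_mat (p - q) A = poly_mat p A - poly_mat q A"
proof -
  let ?N = "max (degree p) (degree q)"
  have "poly_mat (p - q) A = (\<Sum>k\<le>?N. coeff (p - q) k *\<^sub>R mat_power A k)"
    by (intro poly_mat_bound degree_diff_le_max)
  also have "\<dots> = (\<Sum>k\<le>?N. coeff p k *\<^sub>R mat_power A k) - (\<Sum>k\<le>?N. coeff q k *\<^sub>R mat_power A k)"
    by (simp add: scaleR_left_diff_distrib sum_subtractf)
  finally show ?thesis
    by (simp add: poly_mat_bound[symmetric])
qed

lemma poly_mat_smult: "poly_mat (smult c p) A = c *\<^sub>R poly_mat p A"
proof -
  have "poly_mat (smult c p) A = (\<Sum>k\<le>degree p. coeff (smult c p) k *\<^sub>R mat_power A k)"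
    by (intro poly_mat_bound degree_smult_le)
  then show ?thesis
    by (simp add: poly_mat_def scaleR_sum_right)
qed

lemma poly_mat_annihilator_exists:
  fixes A :: "real ^ 'n ^ 'n"
  shows "\<exists>q. q \<noteq> 0 \<and> poly_mat q A = 0"
proof (cases "inj (mat_power A)")
  case False
  then obtain i j where ij: "i \<noteq> j" "mat_power A i = mat_power A j"
    by (auto simp: inj_def)
  let ?q = "monom 1 i - monom 1 j :: real poly"
  have "coeff ?q i \<noteq> 0"
    using ij(1) by simp
  then have "?q \<noteq> 0"
    by (metis coeff_0)
  moreover have "poly_mat (monom 1 i) A = mat_power A i" for i
    by (simp add: poly_mat_def degree_monom_eq if_distrib if_distribR cong: if_cong)
  then have "poly_mat ?q A = 0"
    using ij(2) by (simp add: poly_mat_diff)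
  ultimately show ?thesis by blast
next
  case True
  define N where "N = DIM(real ^ 'n ^ 'n)"
  let ?S = "mat_power A ` {..N}"
  have inj: "inj_on (mat_power A) {..N}"
    using True by (rule inj_on_subset) simp
  have "card ?S = Suc N"
    by (simp add: card_image[OF inj])
  then have "dependent ?S"
    using independent_bound[of ?S] N_def by (metis Suc_n_not_le_n)
  then obtain u where u: "\<exists>v\<in>?S. u v \<noteq> 0" "(\<Sum>v\<in>?S. u v *\<^sub>R v) = 0"
    by (auto simp: dependent_finite)
  define q where "q = (\<Sum>k\<le>N. monom (u (mat_power A k)) k)"
  have cq: "coeff q k = (if k \<le> N then u (mat_power A k) else 0)" for k
    by (simp add: q_def coeff_sum)
  have "degree q \<le> N"
    by (rule degree_le) (simp add: cq)
  then have "poly_mat q A = (\<Sum>k\<le>N. u (mat_power A k) *\<^sub>R mat_power A k)"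
    by (simp add: poly_mat_bound cq)
  also have "\<dots> = 0"
    using u(2) by (simp add: sum.reindex[OF inj])
  finally have "poly_mat q A = 0" .
  moreover obtain k where "k \<le> N" "u (mat_power A k) \<noteq> 0"
    using u(1) by blast
  then have "coeff q k \<noteq> 0"
    by (simp add: cq)
  then have "q \<noteq> 0"
    by (metis coeff_0)
  ultimately show ?thesis by blast
qed

lemma is_min_poly_exists1:
  fixes A :: "real ^ 'n ^ 'n"
  shows "\<exists>!p. is_min_poly A p"
proof -
  obtain q where q: "q \<noteq> 0" "poly_mat q A = 0"
    and least: "\<And>r. r \<noteq> 0 \<Longrightarrow> poly_mat r A = 0 \<Longrightarrow> degree q \<le> degree r"
    using ex_has_least_nat[of "\<lambda>q. q \<noteq> 0 \<and> poly_mat q A = 0" _ degree]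
      poly_mat_annihilator_exists[of A] by blast
  let ?p = "smult (inverse (lead_coeff q)) q"
  have "is_min_poly A ?p"
    using q least by (auto simp: is_min_poly_def poly_mat_smult)
  moreover have "p = p'" if p: "is_min_poly A p" "is_min_poly A p'" for p p'
  proof (rule ccontr)
    assume "p \<noteq> p'"
    have deg: "degree p = degree p'"
      using p unfolding is_min_poly_def by (metis le_antisym leading_coeff_0_iff zero_neq_one)
    have "poly_mat (p - p') A = 0" "p - p' \<noteq> 0"
      using p \<open>p \<noteq> p'\<close> by (simp_all add: poly_mat_diff is_min_poly_def)
    then have "degree p \<le> degree (p - p')"
      using p by (simp add: is_min_poly_def)
    moreover have "degree (p - p') \<le> degree p"
      using degree_diff_le[of p "degree p" p'] deg by simp
    ultimately have "degree (p - p') = degree p" by simp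
    then have "lead_coeff (p - p') = 0"
      using p deg by (simp add: is_min_poly_def)
    with \<open>p - p' \<noteq> 0\<close> show False
      using leading_coeff_0_iff by blast
  qed
  ultimately show ?thesis by blast
qed

definition min_poly :: "real ^ 'n ^ 'n \<Rightarrow> real poly" where
  "min_poly A = (THE p. is_min_poly A p)"

lemma is_min_poly_min_poly: "is_min_poly A (min_poly A)"
  unfolding min_poly_def by (rule theI'[OF is_min_poly_exists1])

end

theory Submission
  imports Defs
begin

text \<open>
  A homomorphism from a product \<open>XY\<close> into the weighted graph is a pair of maps on \<open>X\<close> and \<open>Y\<close> that
  agree on the labelled vertices. Hence the homomorphism number of \<open>XY\<close> is a sum, over the maps \<open>a\<close>
  on \<open>X\<close>, of the weight of \<open>a\<close> times the number \<open>labelled_hom \<beta> Y i j\<close> of weighted maps on \<open>Y\<close>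
  whose labels go to the same vertices \<open>i\<close>, \<open>j\<close> as those of \<open>X\<close> (\<open>hom_number_lprod\<close>). The factor \<open>Y\<close>
  thus matters only through the matrix with entries \<open>labelled_hom \<beta> Y i j\<close>. This matrix is the identity
  for \<open>K1\<close> and, by counting walks, the power \<open>A^k\<close> for the path with \<open>k\<close> edges
  (\<open>labelled_hom_K1\<close>, \<open>labelled_hom_path_graph\<close>).

  By linearity, a combination of paths is a contractor as soon as the same combination of powers of
  \<open>A\<close> is the identity, and a connector as soon as that combination is \<open>A\<close> and all the paths are
  simple, that is, have at least two edges (\<open>is_contractor_path_combination\<close>,
  \<open>is_connector_path_combination\<close>).

  Such matrix identities come from \<open>p(A) = 0\<close>. If \<open>p\<close> has constant coefficient \<open>p_0 \<noteq> 0\<close>, solving for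
  the identity gives the contractor, and multiplying the result by \<open>A\<close> gives the connector. If
  \<open>p_0 = 0\<close>, solving for \<open>A\<close> gives the connector; this needs \<open>p_1 \<noteq> 0\<close>, which holds because a
  symmetric matrix satisfies \<open>A (A B) = 0\<close> only if \<open>A B = 0\<close>, so that a factor \<open>t^2\<close> of \<open>p\<close> could be
  replaced by \<open>t\<close>, against minimality (\<open>symmetric_min_poly_coeff_1_nonzero\<close>).
\<close>

section \<open>Homomorphism numbers of products of 2-labelled graphs\<close>

definition hom_weight :: "('n::finite uprod \<Rightarrow> real) \<Rightarrow> 'z mgraph_scheme \<Rightarrow> (nat \<Rightarrow> 'n) \<Rightarrow> real" where
  "hom_weight \<beta> G \<psi> = (\<Prod>e \<in># edges G. \<beta> (map_uprod \<psi> e))"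

text \<open>
  When \<open>Y\<close> carries both labels at one vertex, this vanishes off the diagonal; this is what makes the
  product formula below hold without any case distinction on coinciding labels.
\<close>

definition labelled_hom :: "('n::finite uprod \<Rightarrow> real) \<Rightarrow> lgraph \<Rightarrow> 'n \<Rightarrow> 'n \<Rightarrow> real" where
  "labelled_hom \<beta> Y i j =
     (\<Sum>\<psi> \<in> {\<psi> \<in> verts Y \<rightarrow>\<^sub>E UNIV. \<psi> (label1 Y) = i \<and> \<psi> (label2 Y) = j}. hom_weight \<beta> Y \<psi>)"

lemma hom_number_eq_sum_hom_weight: "hom_number \<beta> G = (\<Sum>\<psi> \<in> verts G \<rightarrow>\<^sub>E UNIV. hom_weight \<beta> G \<psi>)"
  by (simp add: hom_number_def hom_weight_def)

lemma hom_weight_cong: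
  assumes "finite_graph G" "\<And>v. v \<in> verts G \<Longrightarrow> \<phi> v = \<psi> v"
  shows "hom_weight \<beta> G \<phi> = hom_weight \<beta> G \<psi>"
proof -
  have "map_uprod \<phi> e = map_uprod \<psi> e" if "e \<in># edges G" for e
    using assms that by (intro uprod.map_cong) (auto simp: finite_graph_def)
  then show ?thesis
    unfolding hom_weight_def by (metis (mono_tags, lifting) image_mset_cong)
qed

lemma prod_map_uprod_image_mset:
  "(\<Prod>e \<in># image_mset (map_uprod f) M. \<beta> (map_uprod \<psi> e)) =
     (\<Prod>e \<in># M. \<beta> (map_uprod (\<lambda>v. \<psi> (f v)) e))"
  by (simp add: multiset.map_comp uprod.map_comp comp_def)

lemma graph_parameter_hom_number: "graph_parameter (hom_number \<beta>)"
  unfolding graph_parameter_def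
proof (intro allI impI)
  fix G G' :: mgraph
  assume fin: "finite_graph G" "finite_graph G'" and "graph_iso G G'"
  then obtain f where f: "bij_betw f (verts G) (verts G')"
    and E: "edges G' = image_mset (map_uprod f) (edges G)"
    by (auto simp: graph_iso_def)
  define g where "g = inv_into (verts G) f"
  have gf: "g (f v) = v" if "v \<in> verts G" for v
    using f that by (simp add: g_def bij_betw_def inv_into_f_f)
  have fg: "f (g v) = v" if "v \<in> verts G'" for v
    using f that by (simp add: g_def bij_betw_inv_into_right)
  have fV: "f v \<in> verts G'" if "v \<in> verts G" for v
    using f that by (auto simp: bij_betw_def)
  have gV: "g v \<in> verts G" if "v \<in> verts G'" for v
    using f that by (simp add: g_def bij_betw_def inv_into_into)
  show "hom_number \<beta> G = hom_number \<beta> G'"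
    unfolding hom_number_eq_sum_hom_weight
  proof (rule sum.reindex_bij_witness[where
        i = "\<lambda>\<psi>. restrict (\<lambda>v. \<psi> (f v)) (verts G)" and
        j = "\<lambda>\<phi>. restrict (\<lambda>v. \<phi> (g v)) (verts G')"])
    fix \<phi> :: "nat \<Rightarrow> 'a" assume "\<phi> \<in> verts G \<rightarrow>\<^sub>E UNIV"
    then show "restrict (\<lambda>v. restrict (\<lambda>v. \<phi> (g v)) (verts G') (f v)) (verts G) = \<phi>"
      by (auto simp: fun_eq_iff gf fV PiE_def extensional_def restrict_def)
    have "hom_weight \<beta> G' (restrict (\<lambda>v. \<phi> (g v)) (verts G')) =
        hom_weight \<beta> G (\<lambda>v. restrict (\<lambda>v. \<phi> (g v)) (verts G') (f v))"
      by (simp add: hom_weight_def E prod_map_uprod_image_mset)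
    also have "\<dots> = hom_weight \<beta> G \<phi>"
      using fin(1) by (rule hom_weight_cong) (simp add: fV gf)
    finally show "hom_weight \<beta> G' (restrict (\<lambda>v. \<phi> (g v)) (verts G')) = hom_weight \<beta> G \<phi>" .
  next
    fix \<psi> :: "nat \<Rightarrow> 'a" assume "\<psi> \<in> verts G' \<rightarrow>\<^sub>E UNIV"
    then show "restrict (\<lambda>v. restrict (\<lambda>v. \<psi> (f v)) (verts G) (g v)) (verts G') = \<psi>"
      by (auto simp: fun_eq_iff fg gV PiE_def extensional_def restrict_def)
  qed auto
qed

lemma glue_rep_eqI:
  assumes "equivclp (glue X Y) (sum_encode w) (sum_encode w')"
  shows "glue_rep X Y w = glue_rep X Y w'"
proof -
  have "equivclp (glue X Y) (sum_encode w) u \<longleftrightarrow> equivclp (glue X Y) (sum_encode w') u" for u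
    using assms by (meson equivclp_sym equivclp_trans)
  then show ?thesis
    by (simp add: glue_rep_def)
qed

lemma glue_rep_labels:
  "glue_rep X Y (Inl (label1 X)) = glue_rep X Y (Inr (label1 Y))"
  "glue_rep X Y (Inl (label2 X)) = glue_rep X Y (Inr (label2 Y))"
  by (intro glue_rep_eqI r_into_equivclp; simp add: glue_def)+

text \<open>
  Maps on \<open>X\<close> and \<open>Y\<close> that agree on the labels are constant on each class of identified vertices, so
  their common extension to the product can be read off at the representative of a class, whichever
  factor that representative comes from.
\<close>

lemma glue_rep_respects:
  assumes "a (label1 X) = b (label1 Y)" "a (label2 X) = b (label2 Y)"
  shows "case_sum a b (sum_decode (glue_rep X Y w)) = case_sum a b w"
proof -
  have "case_sum a b (sum_decode u) = case_sum a b (sum_decode v)" if "equivclp (glue X Y) u v" for u v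
    using that
  proof (induction rule: equivclp_induct)
    case (step v w)
    then show ?case
      using assms by (auto simp: glue_def)
  qed simp
  moreover have "equivclp (glue X Y) (sum_encode w) (glue_rep X Y w)"
    unfolding glue_rep_def by (rule LeastI) (rule equivclp_refl)
  ultimately show ?thesis
    by fastforce
qed

lemma hom_weight_lprod:
  "hom_weight \<beta> (unlabel (lprod X Y)) \<psi> =
     hom_weight \<beta> X (\<lambda>v. \<psi> (glue_rep X Y (Inl v))) * hom_weight \<beta> Y (\<lambda>v. \<psi> (glue_rep X Y (Inr v)))"
  unfolding hom_weight_def unlabel_def lprod_def
  by (simp add: multiset.map_comp uprod.map_comp comp_def)

text \<open>
  The sum over maps on the product is reindexed over pairs \<open>(a, b)\<close> that agree on the labels. In one
  direction a map is restricted to the two factors, in the other the pair is evaluated at the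
  representatives, which is well defined by \<open>glue_rep_respects\<close>.
\<close>

lemma hom_number_lprod:
  assumes X: "two_labelled X" and Y: "two_labelled Y"
  shows "hom_number \<beta> (unlabel (lprod X Y)) =
    (\<Sum>a \<in> verts X \<rightarrow>\<^sub>E UNIV. hom_weight \<beta> X a * labelled_hom \<beta> Y (a (label1 X)) (a (label2 X)))"
proof -
  let ?r = "glue_rep X Y" and ?V = "verts (unlabel (lprod X Y))"
  let ?B = "\<lambda>a. {b \<in> verts Y \<rightarrow>\<^sub>E (UNIV :: 'a set). b (label1 Y) = a (label1 X) \<and> b (label2 Y) = a (label2 X)}"
  let ?S = "Sigma (verts X \<rightarrow>\<^sub>E (UNIV :: 'a set)) ?B"
  let ?i = "\<lambda>(a, b). restrict (\<lambda>u. case_sum a b (sum_decode u)) ?V"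
  let ?j = "\<lambda>\<psi>. (restrict (\<lambda>v. \<psi> (?r (Inl v))) (verts X), restrict (\<lambda>v. \<psi> (?r (Inr v))) (verts Y))"
  have V: "?V = ?r ` (Inl ` verts X \<union> Inr ` verts Y)"
    by (simp add: unlabel_def lprod_def)
  have VX: "?r (Inl v) \<in> ?V" if "v \<in> verts X" for v using that unfolding V by blast
  have VY: "?r (Inr v) \<in> ?V" if "v \<in> verts Y" for v using that unfolding V by blast
  have lab: "label1 X \<in> verts X" "label2 X \<in> verts X" "label1 Y \<in> verts Y" "label2 Y \<in> verts Y"
    and fg: "finite_graph X" "finite_graph Y"
    using X Y by (auto simp: two_labelled_def)
  have fin: "finite (verts X \<rightarrow>\<^sub>E (UNIV :: 'a set))" "finite (verts Y \<rightarrow>\<^sub>E (UNIV :: 'a set))"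
    using fg by (auto simp: finite_graph_def intro: finite_PiE)
  have "hom_number \<beta> (unlabel (lprod X Y)) = (\<Sum>(a, b) \<in> ?S. hom_weight \<beta> X a * hom_weight \<beta> Y b)"
    unfolding hom_number_eq_sum_hom_weight
  proof (rule sum.reindex_bij_witness[where i = ?i and j = ?j])
    fix \<psi> :: "nat \<Rightarrow> 'a" assume \<psi>: "\<psi> \<in> ?V \<rightarrow>\<^sub>E UNIV"
    obtain a b where ab: "?j \<psi> = (a, b)" by blast
    have a: "a = restrict (\<lambda>v. \<psi> (?r (Inl v))) (verts X)" and b: "b = restrict (\<lambda>v. \<psi> (?r (Inr v))) (verts Y)"
      using ab by simp_all
    have "a (label1 X) = b (label1 Y)" "a (label2 X) = b (label2 Y)"
      using lab by (simp_all add: a b glue_rep_labels)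
    note resp = glue_rep_respects[OF this]
    have "case_sum a b (sum_decode u) = \<psi> u" if u: "u \<in> ?V" for u
    proof -
      obtain w where w: "u = ?r w" "w \<in> Inl ` verts X \<union> Inr ` verts Y"
        using u unfolding V by (rule imageE)
      then show ?thesis
        using resp[of w] by (auto simp: a b)
    qed
    then have "?i (a, b) = \<psi>"
      using \<psi> by (auto simp: fun_eq_iff PiE_def extensional_def restrict_def)
    then show "?i (?j \<psi>) = \<psi>"
      by (simp only: ab)
    show "?j \<psi> \<in> ?S"
      using lab by (auto simp: glue_rep_labels)
    have "hom_weight \<beta> X a = hom_weight \<beta> X (\<lambda>v. \<psi> (?r (Inl v)))"
      using fg(1) by (rule hom_weight_cong) (simp add: a)
    moreover have "hom_weight \<beta> Y b = hom_weight \<beta> Y (\<lambda>v. \<psi> (?r (Inr v)))"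
      using fg(2) by (rule hom_weight_cong) (simp add: b)
    ultimately show "(case ?j \<psi> of (a, b) \<Rightarrow> hom_weight \<beta> X a * hom_weight \<beta> Y b)
        = hom_weight \<beta> (unlabel (lprod X Y)) \<psi>"
      unfolding ab by (simp add: hom_weight_lprod)
  next
    fix s assume "s \<in> ?S"
    then obtain a b where s: "s = (a, b)" and a: "a \<in> verts X \<rightarrow>\<^sub>E UNIV" and b: "b \<in> ?B a"
      by blast
    have "a (label1 X) = b (label1 Y)" "a (label2 X) = b (label2 Y)"
      using b by simp_all
    note resp = glue_rep_respects[OF this]
    have "restrict (\<lambda>v. ?i s (?r (Inl v))) (verts X) = a"
      using a by (auto simp: fun_eq_iff s resp VX PiE_def extensional_def restrict_def)
    moreover have "restrict (\<lambda>v. ?i s (?r (Inr v))) (verts Y) = b"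
      using b by (auto simp: fun_eq_iff s resp VY PiE_def extensional_def restrict_def)
    ultimately show "?j (?i s) = s"
      by (simp only: s)
    show "?i s \<in> ?V \<rightarrow>\<^sub>E UNIV"
      by (simp add: s)
  qed
  also have "\<dots> = (\<Sum>a \<in> verts X \<rightarrow>\<^sub>E UNIV. \<Sum>b \<in> ?B a. hom_weight \<beta> X a * hom_weight \<beta> Y b)"
    using fin by (intro sum.Sigma[symmetric]) auto
  finally show ?thesis
    by (simp add: labelled_hom_def sum_distrib_left)
qed


section \<open>Labelled homomorphism numbers of paths\<close>

lemma labelled_hom_K1: "labelled_hom \<beta> K1 i j = mat 1 $ i $ j"
proof -
  have "{\<psi> \<in> {0 :: nat} \<rightarrow>\<^sub>E UNIV. \<psi> 0 = i \<and> \<psi> 0 = j} = (if i = j then {\<lambda>x\<in>{0}. i} else {})"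
    by (auto simp: PiE_def extensional_def fun_eq_iff)
  then show ?thesis
    by (simp add: labelled_hom_def hom_weight_def K1_def mat_def)
qed

lemma mat_power_0: "mat_power A 0 = mat 1"
  by (simp add: mat_power_def)

lemma mat_power_Suc: "mat_power A (Suc k) = A ** mat_power A k"
  by (simp add: mat_power_def)

lemma mat_power_Suc2: "mat_power A (Suc k) = mat_power A k ** A"
  by (induction k) (simp_all add: mat_power_0 mat_power_Suc matrix_mul_assoc)

lemma hom_weight_path_graph: "hom_weight \<beta> (path_graph k) \<psi> = (\<Prod>t<k. \<beta> (Upair (\<psi> t) (\<psi> (Suc t))))"
  by (simp add: hom_weight_def path_graph_def multiset.map_comp comp_def lessThan_atLeast0 prod_unfold_prod_mset)

text \<open>
  Weighted walks of length \<open>k\<close> from \<open>i\<close> to \<open>j\<close> are counted by the \<open>k\<close>-th power of the adjacency matrix: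
  removing the last edge of a walk splits it according to the vertex \<open>m\<close> reached after \<open>k\<close> steps.
\<close>

lemma labelled_hom_path_graph:
  "labelled_hom \<beta> (path_graph k) i j = mat_power (adjacency_matrix \<beta>) k $ i $ j"
proof (induction k arbitrary: j)
  case 0
  have "path_graph 0 = K1"
    by (simp add: path_graph_def K1_def)
  then show ?case
    by (simp add: labelled_hom_K1 mat_power_0)
next
  case (Suc k)
  let ?S = "\<lambda>m. {\<psi> \<in> {0..k} \<rightarrow>\<^sub>E (UNIV :: 'a set). \<psi> 0 = i \<and> \<psi> k = m}"
  let ?w = "\<lambda>k \<psi>. (\<Prod>t<k. \<beta> (Upair (\<psi> t) (\<psi> (Suc t))))"
  have L: "labelled_hom \<beta> (path_graph k) i j =
      (\<Sum>\<psi> \<in> {\<psi> \<in> {0..k} \<rightarrow>\<^sub>E UNIV. \<psi> 0 = i \<and> \<psi> k = j}. ?w k \<psi>)" for k j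
    by (simp add: labelled_hom_def hom_weight_path_graph) (simp add: path_graph_def)
  have fin: "finite ({0..k} \<rightarrow>\<^sub>E (UNIV :: 'a set))"
    by (intro finite_PiE) auto
  have "labelled_hom \<beta> (path_graph (Suc k)) i j =
      (\<Sum>(m, \<psi>) \<in> Sigma UNIV ?S. ?w k \<psi> * \<beta> (Upair m j))"
    unfolding L
  proof (rule sum.reindex_bij_witness[where
        i = "\<lambda>(m, \<psi>). \<psi>(Suc k := j)" and j = "\<lambda>\<psi>. (\<psi> k, restrict \<psi> {0..k})"])
    fix \<psi> :: "nat \<Rightarrow> 'a"
    assume \<psi>: "\<psi> \<in> {\<psi> \<in> {0..Suc k} \<rightarrow>\<^sub>E UNIV. \<psi> 0 = i \<and> \<psi> (Suc k) = j}"
    then show "(case (\<psi> k, restrict \<psi> {0..k}) of (m, \<psi>) \<Rightarrow> \<psi>(Suc k := j)) = \<psi>"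
      by (auto simp: fun_eq_iff PiE_def extensional_def)
    show "(\<psi> k, restrict \<psi> {0..k}) \<in> Sigma UNIV ?S"
      using \<psi> by auto
    have "?w k (restrict \<psi> {0..k}) = ?w k \<psi>"
      by (intro prod.cong) auto
    then show "(case (\<psi> k, restrict \<psi> {0..k}) of (m, \<psi>) \<Rightarrow> ?w k \<psi> * \<beta> (Upair m j)) = ?w (Suc k) \<psi>"
      using \<psi> by simp
  next
    fix s assume "s \<in> Sigma UNIV ?S"
    then obtain m \<psi> where s: "s = (m, \<psi>)" and \<psi>: "\<psi> \<in> ?S m"
      by blast
    then show "(\<lambda>\<psi>. (\<psi> k, restrict \<psi> {0..k})) ((\<lambda>(m, \<psi>). \<psi>(Suc k := j)) s) = s"
      by (auto simp: fun_eq_iff PiE_def extensional_def)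
    show "(case s of (m, \<psi>) \<Rightarrow> \<psi>(Suc k := j)) \<in> {\<psi> \<in> {0..Suc k} \<rightarrow>\<^sub>E UNIV. \<psi> 0 = i \<and> \<psi> (Suc k) = j}"
      using \<psi> by (auto simp: s PiE_def extensional_def)
  qed
  also have "\<dots> = (\<Sum>m\<in>UNIV. \<Sum>\<psi> \<in> ?S m. ?w k \<psi> * \<beta> (Upair m j))"
    using fin by (intro sum.Sigma[symmetric]) auto
  also have "\<dots> = (\<Sum>m\<in>UNIV. labelled_hom \<beta> (path_graph k) i m * \<beta> (Upair m j))"
    by (simp add: L sum_distrib_right)
  also have "\<dots> = mat_power (adjacency_matrix \<beta>) (Suc k) $ i $ j"
    by (simp add: Suc.IH mat_power_Suc2 matrix_matrix_mult_def adjacency_matrix_def)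
  finally show ?case .
qed

lemma two_labelled_K1: "two_labelled K1"
  by (simp add: two_labelled_def finite_graph_def K1_def)

lemma two_labelled_path_graph: "two_labelled (path_graph k)"
  by (auto simp: two_labelled_def finite_graph_def path_graph_def)

lemma simple_two_labelled_path_graph:
  assumes "k \<ge> 2"
  shows "simple_two_labelled (path_graph k)"
proof -
  have "inj_on (\<lambda>i. Upair i (Suc i)) {0..<k}"
    by (auto simp: inj_on_def)
  then have "edges (path_graph k) = mset_set ((\<lambda>i. Upair i (Suc i)) ` {0..<k})"
    by (simp add: path_graph_def image_mset_mset_set)
  then have "count (edges (path_graph k)) e \<le> 1" for e
    by (simp add: count_mset_set')
  moreover have "labels_separated (path_graph k)"
    using assms by (auto simp: labels_separated_def path_graph_def)
  ultimately show ?thesis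
    by (simp add: simple_two_labelled_def two_labelled_path_graph)
qed


section \<open>Linear functionals on quantum graphs\<close>

text \<open>
  The linear extension of a function on 2-labelled graphs to quantum graphs. Besides the evaluation
  of a graph parameter, it covers the functionals \<open>labelled_hom \<beta> _ i j\<close> and \<open>h (X _)\<close> for a fixed \<open>X\<close>.
\<close>

definition quantum_extension :: "(lgraph \<Rightarrow> real) \<Rightarrow> quantum_graph \<Rightarrow> real" where
  "quantum_extension f Z = (\<Sum>Y \<in> Poly_Mapping.keys Z. Poly_Mapping.lookup Z Y * f Y)"

lemma quantum_extension_superset:
  assumes "finite S" "Poly_Mapping.keys Z \<subseteq> S"
  shows "quantum_extension f Z = (\<Sum>Y \<in> S. Poly_Mapping.lookup Z Y * f Y)"
  unfolding quantum_extension_def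
  by (rule sum.mono_neutral_left) (use assms in \<open>auto simp: in_keys_iff\<close>)

lemma quantum_extension_add:
  "quantum_extension f (Z + Z') = quantum_extension f Z + quantum_extension f Z'"
proof -
  let ?S = "Poly_Mapping.keys Z \<union> Poly_Mapping.keys Z'"
  have "Poly_Mapping.keys (Z + Z') \<subseteq> ?S" by (rule keys_add)
  then show ?thesis
    by (simp add: quantum_extension_superset[of ?S] lookup_add distrib_right sum.distrib)
qed

lemma quantum_extension_sum:
  "quantum_extension f (\<Sum>k\<in>K. Z k) = (\<Sum>k\<in>K. quantum_extension f (Z k))"
proof (induction K rule: infinite_finite_induct)
  case (insert k K)
  then show ?case by (simp add: quantum_extension_add)
qed (simp_all add: quantum_extension_def)

lemma quantum_extension_single: "quantum_extension f (Poly_Mapping.single X c) = c * f X"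
  by (simp add: quantum_extension_def)

lemma lookup_qscale: "Poly_Mapping.lookup (qscale c Z) Y = c * Poly_Mapping.lookup Z Y"
  by (simp add: qscale_def map.rep_eq when_def)

lemma keys_qscale: "Poly_Mapping.keys (qscale c Z) \<subseteq> Poly_Mapping.keys Z"
  by (auto simp: in_keys_iff lookup_qscale)

lemma quantum_extension_qscale: "quantum_extension f (qscale c Z) = c * quantum_extension f Z"
proof -
  have "quantum_extension f (qscale c Z) =
      (\<Sum>Y \<in> Poly_Mapping.keys Z. Poly_Mapping.lookup (qscale c Z) Y * f Y)"
    by (rule quantum_extension_superset[OF finite_keys keys_qscale])
  also have "\<dots> = c * quantum_extension f Z"
    by (simp add: quantum_extension_def lookup_qscale sum_distrib_left mult.assoc)
  finally show ?thesis .
qed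

lemma qeval_qprod_qsingle:
  "qeval h (qprod (qsingle X) Z) = quantum_extension (\<lambda>Y. h (unlabel (lprod X Y))) Z"
proof -
  have "qprod (qsingle X) Z =
      (\<Sum>Y \<in> Poly_Mapping.keys Z. Poly_Mapping.single (lprod X Y) (Poly_Mapping.lookup Z Y))"
    by (simp add: qprod_def qsingle_def)
  moreover have "qeval h V = quantum_extension (\<lambda>Y. h (unlabel Y)) V" for V
    by (simp add: qeval_def quantum_extension_def)
  ultimately show ?thesis
    by (simp add: quantum_extension_sum quantum_extension_single)
      (simp add: quantum_extension_def)
qed

text \<open>
  Quantum graphs with the same matrix of labelled homomorphism numbers cannot be told apart by gluing
  them to a graph \<open>X\<close>. Applied with \<open>W\<close> the graph \<open>K1\<close> or a single edge, this reduces contractors and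
  connectors to an identity between matrices.
\<close>

lemma qeval_qprod_hom_number:
  assumes X: "two_labelled X" and Z: "\<forall>Y \<in> Poly_Mapping.keys Z. two_labelled Y"
    and W: "two_labelled W"
    and eq: "\<And>i j. quantum_extension (\<lambda>Y. labelled_hom \<beta> Y i j) Z = labelled_hom \<beta> W i j"
  shows "qeval (hom_number \<beta>) (qprod (qsingle X) Z) = hom_number \<beta> (unlabel (lprod X W))"
proof -
  have "qeval (hom_number \<beta>) (qprod (qsingle X) Z) =
     (\<Sum>Y \<in> Poly_Mapping.keys Z. Poly_Mapping.lookup Z Y *
       (\<Sum>a \<in> verts X \<rightarrow>\<^sub>E UNIV. hom_weight \<beta> X a * labelled_hom \<beta> Y (a (label1 X)) (a (label2 X))))"
    using Z by (simp add: qeval_qprod_qsingle quantum_extension_def hom_number_lprod[OF X])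
  also have "\<dots> = (\<Sum>a \<in> verts X \<rightarrow>\<^sub>E UNIV. hom_weight \<beta> X a *
      quantum_extension (\<lambda>Y. labelled_hom \<beta> Y (a (label1 X)) (a (label2 X))) Z)"
    unfolding quantum_extension_def sum_distrib_left
    by (subst sum.swap) (simp add: mult.left_commute)
  also have "\<dots> = hom_number \<beta> (unlabel (lprod X W))"
    by (simp add: eq hom_number_lprod[OF X W])
  finally show ?thesis .
qed

lemma keys_linear_combination:
  "Poly_Mapping.keys (qscale c (\<Sum>k\<in>K. qscale (a k) (qsingle (g k)))) \<subseteq> g ` K"
proof -
  have "Poly_Mapping.keys (\<Sum>k\<in>K. qscale (a k) (qsingle (g k))) \<subseteq>
      (\<Union>k\<in>K. Poly_Mapping.keys (qscale (a k) (qsingle (g k))))"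
    by (rule keys_sum)
  also have "\<dots> \<subseteq> (\<Union>k\<in>K. Poly_Mapping.keys (qsingle (g k)))"
    using keys_qscale by blast
  also have "\<dots> \<subseteq> g ` K"
    by (auto simp: qsingle_def)
  finally show ?thesis
    using keys_qscale by blast
qed

lemma quantum_extension_path_combination:
  "quantum_extension (\<lambda>Y. labelled_hom \<beta> Y i j)
     (qscale c (\<Sum>k\<in>K. qscale (a k) (qsingle (path_graph (m k))))) =
   (c *\<^sub>R (\<Sum>k\<in>K. a k *\<^sub>R mat_power (adjacency_matrix \<beta>) (m k))) $ i $ j"
  by (simp add: quantum_extension_qscale quantum_extension_sum qsingle_def quantum_extension_single
      labelled_hom_path_graph)

lemma is_connector_path_combination:
  assumes "\<And>k. k \<in> K \<Longrightarrow> m k \<ge> 2"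
    and "c *\<^sub>R (\<Sum>k\<in>K. a k *\<^sub>R mat_power (adjacency_matrix \<beta>) (m k)) = adjacency_matrix \<beta>"
  shows "is_connector (hom_number \<beta>) (qscale c (\<Sum>k\<in>K. qscale (a k) (qsingle (path_graph (m k)))))"
    (is "is_connector _ ?Z")
proof -
  have simple: "\<forall>Y \<in> Poly_Mapping.keys ?Z. simple_two_labelled Y"
    using keys_linear_combination[of c a "\<lambda>k. path_graph (m k)" K] assms(1)
      simple_two_labelled_path_graph by blast
  have P1: "labelled_hom \<beta> (path_graph 1) i j = adjacency_matrix \<beta> $ i $ j" for i j
    by (simp add: labelled_hom_path_graph mat_power_0 mat_power_Suc)
  show ?thesis
    unfolding is_connector_def
  proof (intro conjI allI impI graph_parameter_hom_number simple)
    fix X assume "two_labelled X"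
    then show "qeval (hom_number \<beta>) (qprod (qsingle X) ?Z) =
        hom_number \<beta> (unlabel (lprod X (path_graph 1)))"
      by (rule qeval_qprod_hom_number)
        (use simple in \<open>simp_all add: simple_two_labelled_def two_labelled_path_graph P1
          quantum_extension_path_combination assms(2) del: One_nat_def\<close>)
  qed
qed

lemma is_contractor_path_combination:
  assumes "c *\<^sub>R (\<Sum>k\<in>K. a k *\<^sub>R mat_power (adjacency_matrix \<beta>) (m k)) = mat 1"
  shows "is_contractor (hom_number \<beta>) (qscale c (\<Sum>k\<in>K. qscale (a k) (qsingle (path_graph (m k)))))"
    (is "is_contractor _ ?Z")
proof -
  have tl: "\<forall>Y \<in> Poly_Mapping.keys ?Z. two_labelled Y"
    using keys_linear_combination[of c a "\<lambda>k. path_graph (m k)" K] two_labelled_path_graph by blast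
  show ?thesis
    unfolding is_contractor_def
  proof (intro conjI allI impI graph_parameter_hom_number tl)
    fix X assume "two_labelled X"
    then show "qeval (hom_number \<beta>) (qprod (qsingle X) ?Z) = hom_number \<beta> (unlabel (lprod X K1))"
      by (rule qeval_qprod_hom_number)
        (use tl in \<open>simp_all add: two_labelled_K1 labelled_hom_K1
          quantum_extension_path_combination assms\<close>)
  qed
qed


section \<open>The minimum polynomial of a symmetric matrix\<close>

lemma matrix_mult_sum_right: "A ** (\<Sum>k\<in>K. B k) = (\<Sum>k\<in>K. (A :: real^'n^'n) ** B k)"
  by (induction K rule: infinite_finite_induct) (simp_all add: matrix_add_ldistrib)

lemma matrix_mult_sum_scaleR_mat_power:
  "A ** (\<Sum>k\<in>K. a k *\<^sub>R mat_power A k) = (\<Sum>k\<in>K. a k *\<^sub>R mat_power A (Suc k))"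
  by (simp add: matrix_mult_sum_right mat_power_Suc matrix_scalar_ac flip: scalar_matrix_assoc)

lemma poly_mat_pCons: "poly_mat (pCons c q) A = c *\<^sub>R mat 1 + A ** poly_mat q A"
proof -
  have "poly_mat (pCons c q) A = (\<Sum>k\<le>Suc (degree q). coeff (pCons c q) k *\<^sub>R mat_power A k)"
    by (rule poly_mat_bound) (rule degree_pCons_le)
  also have "\<dots> = c *\<^sub>R mat 1 + (\<Sum>k\<le>degree q. coeff q k *\<^sub>R mat_power A (Suc k))"
    by (subst sum.atMost_Suc_shift) (simp add: mat_power_0)
  also have "\<dots> = c *\<^sub>R mat 1 + A ** poly_mat q A"
    by (simp add: matrix_mult_sum_scaleR_mat_power poly_mat_def)
  finally show ?thesis .
qed

lemma poly_mat_nonzero_of_degree_less: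
  assumes "is_min_poly A p" "q \<noteq> 0" "degree q < degree p"
  shows "poly_mat q A \<noteq> 0"
  using assms by (auto simp: is_min_poly_def)

lemma is_min_poly_nonzero: "is_min_poly A p \<Longrightarrow> p \<noteq> 0"
  by (auto simp: is_min_poly_def)

text \<open>
  For every polynomial \<open>q\<close>, the matrix \<open>q(A)\<close> multiplies a vector killed by \<open>A\<close> by the constant
  coefficient of \<open>q\<close>; take \<open>q = p\<close>, where \<open>p(A) = 0\<close>. Conversely, if \<open>p = t q\<close>, then \<open>q(A) \<noteq> 0\<close> by minimality, and every vector in its range is killed
  by \<open>A\<close>.
\<close>

lemma is_eigenvalue_0_iff:
  assumes p: "is_min_poly A p"
  shows "is_eigenvalue A 0 \<longleftrightarrow> coeff p 0 = 0"
proof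
  assume "is_eigenvalue A 0"
  then obtain v where v: "v \<noteq> 0" "A *v v = 0"
    by (auto simp: is_eigenvalue_def)
  have "mat_power A k *v v = (if k = 0 then v else 0)" for k
    by (cases k) (simp_all add: mat_power_0 mat_power_Suc2 v(2) flip: matrix_vector_mul_assoc)
  then have "poly_mat q A *v v = coeff q 0 *\<^sub>R v" for q
  proof (induction q)
    case (pCons c q)
    then show ?case
      by (simp add: poly_mat_pCons matrix_vector_mult_add_rdistrib
          matrix_vector_mult_scaleR v(2) flip: matrix_vector_mul_assoc scaleR_matrix_vector_assoc)
  qed (simp add: poly_mat_def)
  from this[of p] show "coeff p 0 = 0"
    using p v(1) by (simp add: is_min_poly_def)
next
  assume "coeff p 0 = 0"
  then obtain q where q: "p = pCons 0 q"
    by (cases p) auto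
  then have "q \<noteq> 0"
    using is_min_poly_nonzero[OF p] by auto
  then have "poly_mat q A \<noteq> 0"
    using poly_mat_nonzero_of_degree_less[OF p] by (simp add: q)
  then obtain x where "poly_mat q A *v x \<noteq> 0"
    by (metis matrix_eq matrix_vector_mult_0)
  moreover have "A *v (poly_mat q A *v x) = 0"
    using p by (simp add: is_min_poly_def q poly_mat_pCons matrix_vector_mul_assoc)
  ultimately show "is_eigenvalue A 0"
    by (auto simp: is_eigenvalue_def)
qed

text \<open>
  For symmetric \<open>A\<close> and \<open>y = A (B x)\<close>, the squared norm of \<open>y\<close> is the inner product of \<open>B x\<close> with \<open>A y\<close>.
\<close>

lemma symmetric_mult_self_eq_0:
  fixes A B :: "real ^ 'n ^ 'n"
  assumes sym: "transpose A = A" and "A ** (A ** B) = 0"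
  shows "A ** B = 0"
proof -
  have "A *v (B *v x) = 0" for x
  proof -
    let ?y = "A *v (B *v x)"
    have "?y \<bullet> ?y = (B *v x) \<bullet> (A *v ?y)"
      using dot_lmul_matrix[of "B *v x" A ?y] sym by (metis transpose_matrix_vector)
    also have "A *v ?y = 0"
      using assms(2) by (simp add: matrix_vector_mul_assoc matrix_mul_assoc)
    finally show ?thesis by simp
  qed
  then show ?thesis
    by (simp add: matrix_eq matrix_vector_mul_assoc)
qed

text \<open>
  If \<open>p = t^2 r\<close>, then \<open>t r\<close> would already annihilate the symmetric matrix \<open>A\<close>, in smaller degree.
\<close>

lemma symmetric_min_poly_coeff_1_nonzero:
  assumes p: "is_min_poly A p" and sym: "transpose A = A" and "coeff p 0 = 0"
  shows "coeff p 1 \<noteq> 0"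
proof
  assume "coeff p 1 = 0"
  obtain q where q: "p = pCons 0 q"
    using \<open>coeff p 0 = 0\<close> by (cases p) auto
  obtain r where r: "q = pCons 0 r"
    using \<open>coeff p 1 = 0\<close> q by (cases q) auto
  have "A ** (A ** poly_mat r A) = 0"
    using p by (simp add: is_min_poly_def q r poly_mat_pCons)
  then have "poly_mat q A = 0"
    using symmetric_mult_self_eq_0[OF sym] by (simp add: r poly_mat_pCons)
  moreover have "q \<noteq> 0"
    using is_min_poly_nonzero[OF p] q by auto
  ultimately show False
    using poly_mat_nonzero_of_degree_less[OF p] by (simp add: q)
qed

lemma transpose_adjacency_matrix: "transpose (adjacency_matrix \<beta>) = adjacency_matrix \<beta>"
proof -
  have "Upair i j = Upair j i" for i j :: 'a
    by (simp add: Upair_inject)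
  then show ?thesis
    unfolding transpose_def adjacency_matrix_def vec_eq_iff vec_lambda_beta by metis
qed


section \<open>Connectors and contractors from the minimum polynomial\<close>

theorem theorem7:
  fixes \<beta> :: "'n::finite uprod \<Rightarrow> real"
    and A :: "real ^ 'n ^ 'n"
    and p :: "real poly"
    and l :: nat
  assumes A: "A = adjacency_matrix \<beta>"
    and p: "p = min_poly A"
    and l: "l = degree p"
  shows "(coeff p 0 \<noteq> 0 \<longleftrightarrow> \<not> is_eigenvalue A 0) \<and>
    (coeff p 0 \<noteq> 0 \<longrightarrow>
      is_connector (hom_number \<beta>)
        (qscale (- (1 / coeff p 0)) (\<Sum>k = 1..l. qscale (coeff p k) (qsingle (path_graph (k + 1))))) \<and>
      is_contractor (hom_number \<beta>)
        (qscale (- (1 / coeff p 0)) (\<Sum>k = 1..l. qscale (coeff p k) (qsingle (path_graph k))))) \<and>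
    (coeff p 0 = 0 \<longrightarrow>
      coeff p 1 \<noteq> 0 \<and>
      is_connector (hom_number \<beta>)
        (qscale (- (1 / coeff p 1)) (\<Sum>k = 2..l. qscale (coeff p k) (qsingle (path_graph k)))))"
proof (intro conjI impI)
  have mp: "is_min_poly A p"
    using p is_min_poly_min_poly by simp
  then have pA: "(\<Sum>k\<le>l. coeff p k *\<^sub>R mat_power A k) = 0"
    by (simp add: is_min_poly_def poly_mat_def l)
  have split0: "(\<Sum>k\<le>l. f k) = f 0 + (\<Sum>k=1..l. f k)" for f :: "nat \<Rightarrow> real^'n^'n"
    by (simp add: sum.atLeast_Suc_atMost atMost_atLeast0)
  have pA1: "(\<Sum>k=1..l. coeff p k *\<^sub>R mat_power A k) = - (coeff p 0 *\<^sub>R mat 1)"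
    using pA unfolding split0 by (simp add: mat_power_0 add_eq_0_iff)
  show "coeff p 0 \<noteq> 0 \<longleftrightarrow> \<not> is_eigenvalue A 0"
    using is_eigenvalue_0_iff[OF mp] by simp
  {
    \<comment> \<open>Solving \<open>p(A) = 0\<close> for the identity gives the contractor, and one more factor \<open>A\<close> the connector.\<close>
    assume p0: "coeff p 0 \<noteq> 0"
    show "is_contractor (hom_number \<beta>)
        (qscale (- (1 / coeff p 0)) (\<Sum>k = 1..l. qscale (coeff p k) (qsingle (path_graph k))))"
      by (rule is_contractor_path_combination) (use p0 in \<open>simp add: pA1[unfolded A One_nat_def]\<close>)
    have "(\<Sum>k=1..l. coeff p k *\<^sub>R mat_power A (k + 1)) = A ** (- (coeff p 0 *\<^sub>R mat 1))"
      unfolding pA1[symmetric] matrix_mult_sum_scaleR_mat_power by simp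
    also have "\<dots> = - (coeff p 0 *\<^sub>R A)"
      by (simp add: matrix_scalar_ac flip: scaleR_minus_left)
    finally show "is_connector (hom_number \<beta>)
        (qscale (- (1 / coeff p 0)) (\<Sum>k = 1..l. qscale (coeff p k) (qsingle (path_graph (k + 1)))))"
      using p0 by (intro is_connector_path_combination) (simp_all add: A)
  }
  {
    assume p0: "coeff p 0 = 0"
    show p1: "coeff p 1 \<noteq> 0"
      by (rule symmetric_min_poly_coeff_1_nonzero[OF mp _ p0]) (simp add: A transpose_adjacency_matrix)
    \<comment> \<open>The linear term can be split off from the sum only if there is one.\<close>
    then have "1 \<le> l"
      unfolding l by (rule le_degree)
    then have "(\<Sum>k=1..l. coeff p k *\<^sub>R mat_power A k) =
        coeff p 1 *\<^sub>R A + (\<Sum>k=2..l. coeff p k *\<^sub>R mat_power A k)"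
      by (simp add: sum.atLeast_Suc_atMost mat_power_Suc mat_power_0 numeral_2_eq_2)
    then have "(\<Sum>k=2..l. coeff p k *\<^sub>R mat_power A k) = - (coeff p 1 *\<^sub>R A)"
      using pA1 p0 by (simp add: add_eq_0_iff)
    then show "is_connector (hom_number \<beta>)
        (qscale (- (1 / coeff p 1)) (\<Sum>k = 2..l. qscale (coeff p k) (qsingle (path_graph k))))"
      using p1 by (intro is_connector_path_combination) (simp_all add: A)
  }
qed

end
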